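(* Let $F(\mathcal{T})$ be the function on the tangent bundle $T(\mathcal{E}(S,\mathcal{T})_1)$ of $\mathcal{E}(S,\mathcal{T})_1$ given by $$((A_{ijk}),(v_{ijk}))\mapsto\max_{(i,j,k)\in\mathcal{J}}\left\{\frac{v_{ijk}}{A_{ijk}}\right\},$$ where $(A_{ijk})\in\mathcal{E}(S,\mathcal{T})_1$ and $(v_{ijk})$ is a tangent vector at that point. Then $F(\mathcal{T})$ is a Finsler structure on $\mathcal{E}(S,\mathcal{T})_1$ and the metric $\eta$ is induced by it; that is, for all $A,B\in\mathcal{E}(S,\mathcal{T})_1$, $$\eta(A,B)=\inf_c\int_0^1F(\mathcal{T})(\dot c(t))\,dt,$$ where $c$ ranges over all piecewise $C^1$ curves $c:[0,1]\to\mathcal{E}(S,\mathcal{T})_1$ with $c(0)=A$ and $c(1)=B$.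
   Context: $\mathbb{R}_+^*$ denotes the set of positive reals. Let $S$ be a compact surface, possibly with boundary, and $\mathcal{T}$ a finite triangulation of $S$ with set of edges $E(\mathcal{T})=\{e_i\}$. Fix a set $\mathcal{J}$ of ordered triples $(i,j,k)$ of edge indices such that: (1) for each $(i,j,k)\in\mathcal{J}$, $e_i,e_j,e_k$ are the edges of a face of $\mathcal{T}$; (2) if a face has edges $e_i,e_j,e_k$, some permutation of $(i,j,k)$ is in $\mathcal{J}$; (3) if $(i,j,k)\in\mathcal{J}$, no odd permutation of it is in $\mathcal{J}$; (4) if $(i,j,k)\in\mathcal{J}$, all even permutations of it are in $\mathcal{J}$. $\mathcal{E}(S,\mathcal{T})$ is the set of singular Euclidean metrics $\mu$ on $S$ adapted to $\mathcal{T}$ (each face is a Euclidean triangle; the metric is locally Euclidean except perhaps at the vertices); such $\mu$ is determined by its edge lengths $l_\mu(e_i)>0$, which are arbitrary subject to the strict triangle inequalities for each face. It is identified with its image in $(\mathbb{R}_+^* )^{\mathcal{J}}$ under the injective map $\mu\mapsto(A_{ijk})$, $A_{ijk}=\frac{l_\mu(e_j)+l_\mu(e_k)-l_\mu(e_i)}{2}$. This image is the set of $(A_{ijk})\in(\mathbb{R}_+^* )^{\mathcal{J}}$ with $A_{jki}+A_{kij}=A_{j'k'i}+A_{k'ij'}$ whenever $(i,j,k),(i,j',k')\in\mathcal{J}$ with $j\ne j'$, $k\neq k'$ (both sides equal the length of the interior edge $e_i$). $\mathrm{Ar}(A)$ is the area of the singular flat metric corresponding to $A$, i.e. the sum over the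 faces of $\mathcal{T}$ (with edges $e_i,e_j,e_k$, $(i,j,k)\in\mathcal{J}$) of $\sqrt{(A_{ijk}+A_{jki}+A_{kij})A_{ijk}A_{jki}A_{kij}}$. Set $\mathcal{E}(S,\mathcal{T})_1=\{A\in\mathcal{E}(S,\mathcal{T}):\mathrm{Ar}(A)=1\}$, an embedded differentiable submanifold of $(\mathbb{R}_+^* )^{\mathcal{J}}$, whose tangent vectors are regarded as vectors in $\mathbb{R}^{\mathcal{J}}$. The (not necessarily symmetric) metric $\eta$ on it is $\eta(A,B)=\log\max_{(i,j,k)\in\mathcal{J}}\frac{B_{ijk}}{A_{ijk}}$. A Minkowski norm on a real vector space $V$ is a function $\|\cdot\|:V\to[0,\infty)$ such that for all $v,w\in V$: $\|v\|=0$ iff $v=0$; $\|tv\|=t\|v\|$ for $t>0$; and $\|tv+(1-t)w\|\le t\|v\|+(1-t)\|w\|$ for $t\in[0,1]$ (no symmetry is required). A Finsler structure on a differentiable manifold $M$ is a continuous function $F:TM\to[0,\infty)$ whose restriction to each tangent space $T_xM$ is a Minkowski norm. *)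

theory Defs
  imports "HOL-Analysis.Analysis"
begin

section \<open>Triangulated surfaces\<close>

text \<open>Second countability follows from compactness. Connectedness is not required.\<close>

definition compact_surface :: "'s topology \<Rightarrow> bool" where
  "compact_surface S \<longleftrightarrow>
     compact_space S \<and> Hausdorff_space S \<and>
     (\<forall>x\<in>topspace S. \<exists>U V. openin S U \<and> x \<in> U \<and>
        openin (top_of_set {p :: real \<times> real. 0 \<le> snd p}) V \<and>
        subtopology S U homeomorphic_space top_of_set V)"

definition triangulation_of :: "'s topology \<Rightarrow> 'a::euclidean_space set set \<Rightarrow> bool" where
  "triangulation_of S \<T> \<longleftrightarrow>
     simplicial_complex \<T> \<and> top_of_set (\<Union>\<T>) homeomorphic_space S"

definition edges :: "'a::euclidean_space set set \<Rightarrow> 'a set set" where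
  "edges \<T> = {\<sigma>\<in>\<T>. 1 simplex \<sigma>}"

definition faces :: "'a::euclidean_space set set \<Rightarrow> 'a set set" where
  "faces \<T> = {\<sigma>\<in>\<T>. 2 simplex \<sigma>}"

text \<open>Edges are indexed by a finite type \<open>'i\<close> through a map \<open>e\<close>, a bijection of \<open>'i\<close> onto
  \<open>edges \<T>\<close>.  The three edges of a face are distinct, so in the next definition the indices
  \<open>i\<close>, \<open>j\<close>, \<open>k\<close> are distinct as well.\<close>

definition face_triple ::
    "'a::euclidean_space set set \<Rightarrow> ('i \<Rightarrow> 'a set) \<Rightarrow> 'a set \<Rightarrow> 'i \<times> 'i \<times> 'i \<Rightarrow> bool" where
  "face_triple \<T> e f = (\<lambda>(i, j, k). {\<sigma>\<in>edges \<T>. \<sigma> face_of f} = {e i, e j, e k})"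

definition admissible_triples ::
    "'a::euclidean_space set set \<Rightarrow> ('i \<Rightarrow> 'a set) \<Rightarrow> ('i \<times> 'i \<times> 'i) set \<Rightarrow> bool" where
  "admissible_triples \<T> e J \<longleftrightarrow>
     (\<forall>t\<in>J. \<exists>f\<in>faces \<T>. face_triple \<T> e f t) \<and>
     (\<forall>f\<in>faces \<T>. \<forall>i j k. face_triple \<T> e f (i, j, k) \<longrightarrow>
        (i, j, k) \<in> J \<or> (j, k, i) \<in> J \<or> (k, i, j) \<in> J \<or>
        (j, i, k) \<in> J \<or> (i, k, j) \<in> J \<or> (k, j, i) \<in> J) \<and>
     (\<forall>i j k. (i, j, k) \<in> J \<longrightarrow> (j, i, k) \<notin> J \<and> (i, k, j) \<notin> J \<and> (k, j, i) \<notin> J) \<and>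
     (\<forall>i j k. (i, j, k) \<in> J \<longrightarrow> (j, k, i) \<in> J \<and> (k, i, j) \<in> J)"


section \<open>Singular Euclidean metrics adapted to a triangulation\<close>

text \<open>A singular Euclidean metric is represented by its edge lengths.\<close>

definition edge_lengths ::
    "'a::euclidean_space set set \<Rightarrow> ('i \<Rightarrow> 'a set) \<Rightarrow> ('i \<Rightarrow> real) set" where
  "edge_lengths \<T> e =
     {l. (\<forall>i. 0 < l i) \<and>
         (\<forall>f\<in>faces \<T>. \<forall>i j k. face_triple \<T> e f (i, j, k) \<longrightarrow> l i < l j + l k)}"

text \<open>The space \<open>\<real>\<^sup>J\<close> is realised as the coordinate subspace of \<open>real^('i \<times> 'i \<times> 'i)\<close> of the
  vectors whose components outside \<open>J\<close> vanish.\<close>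

definition metric_coords ::
    "('i \<times> 'i \<times> 'i) set \<Rightarrow> ('i \<Rightarrow> real) \<Rightarrow> real^('i::finite \<times> 'i \<times> 'i)" where
  "metric_coords J l =
     (\<chi> t. if t \<in> J then (case t of (i, j, k) \<Rightarrow> (l j + l k - l i) / 2) else 0)"

definition sing_metrics ::
    "'a::euclidean_space set set \<Rightarrow> ('i \<Rightarrow> 'a set) \<Rightarrow> ('i \<times> 'i \<times> 'i) set \<Rightarrow>
     (real^('i::finite \<times> 'i \<times> 'i)) set" where
  "sing_metrics \<T> e J = metric_coords J ` edge_lengths \<T> e"

definition triple_area :: "real^('i::finite \<times> 'i \<times> 'i) \<Rightarrow> 'i \<times> 'i \<times> 'i \<Rightarrow> real" where
  "triple_area A = (\<lambda>(i, j, k).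
     sqrt ((A $ (i, j, k) + A $ (j, k, i) + A $ (k, i, j)) *
           A $ (i, j, k) * A $ (j, k, i) * A $ (k, i, j)))"

text \<open>\<open>J\<close> contains exactly three triples of edges of a face, cyclic permutations of one another;
  they have the same \<open>triple_area\<close>, so the choice below is immaterial.\<close>

definition area ::
    "'a::euclidean_space set set \<Rightarrow> ('i \<Rightarrow> 'a set) \<Rightarrow> ('i \<times> 'i \<times> 'i) set \<Rightarrow>
     real^('i::finite \<times> 'i \<times> 'i) \<Rightarrow> real" where
  "area \<T> e J A = (\<Sum>f\<in>faces \<T>. triple_area A (SOME t. t \<in> J \<and> face_triple \<T> e f t))"

definition unit_metrics ::
    "'a::euclidean_space set set \<Rightarrow> ('i \<Rightarrow> 'a set) \<Rightarrow> ('i \<times> 'i \<times> 'i) set \<Rightarrow>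
     (real^('i::finite \<times> 'i \<times> 'i)) set" where
  "unit_metrics \<T> e J = {A\<in>sing_metrics \<T> e J. area \<T> e J A = 1}"

definition eta ::
    "('i \<times> 'i \<times> 'i) set \<Rightarrow> real^('i::finite \<times> 'i \<times> 'i) \<Rightarrow> real^('i \<times> 'i \<times> 'i) \<Rightarrow> real" where
  "eta J A B = ln (Max ((\<lambda>t. B $ t / A $ t) ` J))"

definition F_norm ::
    "('i \<times> 'i \<times> 'i) set \<Rightarrow> (real^('i::finite \<times> 'i \<times> 'i)) \<times> (real^('i \<times> 'i \<times> 'i)) \<Rightarrow> real" where
  "F_norm J = (\<lambda>(A, v). Max ((\<lambda>t. v $ t / A $ t) ` J))"


section \<open>Finsler structures on embedded submanifolds\<close>

definition C1_map_on :: "'a::real_normed_vector set \<Rightarrow> ('a \<Rightarrow> 'b::real_normed_vector) \<Rightarrow> bool" where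
  "C1_map_on U g \<longleftrightarrow>
     (\<exists>g' :: 'a \<Rightarrow> 'a \<Rightarrow>\<^sub>L 'b.
        (\<forall>x\<in>U. (g has_derivative blinfun_apply (g' x)) (at x)) \<and> continuous_on U g')"

definition embedded_submanifold :: "'a::euclidean_space set \<Rightarrow> bool" where
  "embedded_submanifold M \<longleftrightarrow>
     (\<exists>d. \<forall>x\<in>M. \<exists>U V \<phi> \<psi> L.
        open U \<and> x \<in> U \<and> open V \<and> homeomorphism U V \<phi> \<psi> \<and>
        C1_map_on U \<phi> \<and> C1_map_on V \<psi> \<and>
        subspace (L :: 'a set) \<and> dim L = d \<and> \<phi> ` (M \<inter> U) = V \<inter> L)"

definition tangent_space :: "'a::real_normed_vector set \<Rightarrow> 'a \<Rightarrow> 'a set" where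
  "tangent_space M x =
     {v. \<exists>\<epsilon>>0. \<exists>c. c ` {-\<epsilon><..<\<epsilon>} \<subseteq> M \<and> c C1_differentiable_on {-\<epsilon><..<\<epsilon>} \<and>
           c 0 = x \<and> (c has_vector_derivative v) (at 0)}"

definition tangent_bundle :: "'a::real_normed_vector set \<Rightarrow> ('a \<times> 'a) set" where
  "tangent_bundle M = (SIGMA x:M. tangent_space M x)"

definition minkowski_norm_on :: "'a::real_vector set \<Rightarrow> ('a \<Rightarrow> real) \<Rightarrow> bool" where
  "minkowski_norm_on V N \<longleftrightarrow>
     subspace V \<and>
     (\<forall>v\<in>V. 0 \<le> N v) \<and>
     (\<forall>v\<in>V. N v = 0 \<longleftrightarrow> v = 0) \<and>
     (\<forall>v\<in>V. \<forall>t>0. N (t *\<^sub>R v) = t * N v) \<and>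
     (\<forall>v\<in>V. \<forall>w\<in>V. \<forall>t\<in>{0..1}. N (t *\<^sub>R v + (1 - t) *\<^sub>R w) \<le> t * N v + (1 - t) * N w)"

definition finsler_structure_on :: "'a::euclidean_space set \<Rightarrow> ('a \<times> 'a \<Rightarrow> real) \<Rightarrow> bool" where
  "finsler_structure_on M F \<longleftrightarrow>
     embedded_submanifold M \<and>
     continuous_on (tangent_bundle M) F \<and>
     (\<forall>x\<in>M. minkowski_norm_on (tangent_space M x) (\<lambda>v. F (x, v)))"

text \<open>The derivative is required to extend continuously to the end points of each piece.  The
  predicate \<open>piecewise_C1_differentiable_on\<close> does not ask for this and so admits curves of infinite
  length, on which \<open>integral\<close> takes its default value 0.\<close>

definition piecewise_C1_curve :: "(real \<Rightarrow> 'a::real_normed_vector) \<Rightarrow> bool" where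
  "piecewise_C1_curve c \<longleftrightarrow>
     (\<exists>(n::nat) p. p 0 = 0 \<and> p n = 1 \<and> (\<forall>m<n. p m < p (Suc m)) \<and>
        (\<forall>m<n. \<exists>D. continuous_on {p m..p (Suc m)} D \<and>
           (\<forall>t\<in>{p m..p (Suc m)}. (c has_vector_derivative D t) (at t within {p m..p (Suc m)}))))"

definition curves_from_to ::
    "'a::real_normed_vector set \<Rightarrow> 'a \<Rightarrow> 'a \<Rightarrow> (real \<Rightarrow> 'a) set" where
  "curves_from_to M x y =
     {c. piecewise_C1_curve c \<and> c ` {0..1} \<subseteq> M \<and> c 0 = x \<and> c 1 = y}"

text \<open>At the finitely many corners of \<open>c\<close> the value of \<open>vector_derivative\<close> is irrelevant to the
  integral.\<close>

definition finsler_length :: "('a::real_normed_vector \<times> 'a \<Rightarrow> real) \<Rightarrow> (real \<Rightarrow> 'a) \<Rightarrow> real" where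
  "finsler_length F c =
     integral {0..1} (\<lambda>t. F (c t, vector_derivative c (at t within {0..1})))"

end

theory Submission
  imports Defs
begin

text \<open>
  The space of metrics is an open convex cone in a linear subspace, cut out by positivity of the
  coordinates, and \<open>r = sqrt area\<close> is homogeneous of degree 1 on it.  Radial rescaling identifies the
  level set \<open>r = 1\<close> with the affine slice where the coordinates sum to 1, which gives a chart, and its
  tangent space at \<open>A\<close> is the kernel of the derivative of \<open>r\<close>.  This derivative is strictly increasing
  in each coordinate, so a tangent vector without positive coordinate vanishes: \<open>F\<close> is a Minkowski norm.
  Along a curve, \<open>F\<close> dominates the logarithmic derivative of every coordinate, so lengths are at
  least \<open>\<eta>\<close>; the segment from \<open>A\<close> to \<open>B\<close>, rescaled to area 1, has length exactly \<open>\<eta>\<close>.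
\<close>

section \<open>Continuously differentiable maps\<close>

lemma C1_map_on_imp_continuous_on: "C1_map_on U f \<Longrightarrow> continuous_on U f"
  unfolding C1_map_on_def
  by (meson continuous_at_imp_continuous_on has_derivative_continuous)

lemma C1_map_on_bounded_linear: "bounded_linear f \<Longrightarrow> C1_map_on U f"
  unfolding C1_map_on_def
  by (rule exI[of _ "\<lambda>_. Blinfun f"])
    (auto simp: bounded_linear_Blinfun_apply intro: bounded_linear_imp_has_derivative)

lemma C1_map_on_ident: "C1_map_on U (\<lambda>x. x)"
  by (rule C1_map_on_bounded_linear[OF bounded_linear_ident])

lemma C1_map_on_const: "C1_map_on U (\<lambda>_. c)"
  unfolding C1_map_on_def by (rule exI[of _ "\<lambda>_. 0"]) (auto simp: zero_blinfun.rep_eq)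

lemma C1_map_on_add:
  assumes "C1_map_on U f" "C1_map_on U g"
  shows "C1_map_on U (\<lambda>x. f x + g x)"
proof -
  obtain f' g' where f: "\<forall>x\<in>U. (f has_derivative blinfun_apply (f' x)) (at x)" "continuous_on U f'"
    and g: "\<forall>x\<in>U. (g has_derivative blinfun_apply (g' x)) (at x)" "continuous_on U g'"
    using assms unfolding C1_map_on_def by blast
  show ?thesis
    unfolding C1_map_on_def
    by (rule exI[of _ "\<lambda>x. f' x + g' x"])
      (use f g in \<open>auto simp: plus_blinfun.rep_eq intro!: has_derivative_add continuous_intros\<close>)
qed

lemma C1_map_on_sum:
  assumes "finite I" "\<And>i. i \<in> I \<Longrightarrow> C1_map_on U (f i)"
  shows "C1_map_on U (\<lambda>x. \<Sum>i\<in>I. f i x)"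
  using assms by (induction I rule: finite_induct) (auto intro: C1_map_on_const C1_map_on_add)

text \<open>\<open>C1_map_on\<close> asks for a derivative that is continuous in the operator norm.
  The product rule is therefore written as an explicit combination of bounded linear maps, from
  which continuity can be read off.\<close>

lemma C1_map_on_scaleR:
  fixes f :: "'a::real_normed_vector \<Rightarrow> real"
  assumes "C1_map_on U f" "C1_map_on U g"
  shows "C1_map_on U (\<lambda>x. f x *\<^sub>R g x)"
proof -
  obtain f' g' where f: "\<forall>x\<in>U. (f has_derivative blinfun_apply (f' x)) (at x)" "continuous_on U f'"
    and g: "\<forall>x\<in>U. (g has_derivative blinfun_apply (g' x)) (at x)" "continuous_on U g'"
    using assms unfolding C1_map_on_def by blast
  have c: "continuous_on U f" "continuous_on U g"
    using assms by (auto intro: C1_map_on_imp_continuous_on)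
  have "\<forall>x\<in>U. ((\<lambda>x. f x *\<^sub>R g x) has_derivative
      blinfun_apply (f x *\<^sub>R g' x + (blinfun_scaleR_left (g x) o\<^sub>L f' x))) (at x)"
  proof
    fix x assume "x \<in> U"
    then show "((\<lambda>x. f x *\<^sub>R g x) has_derivative
      blinfun_apply (f x *\<^sub>R g' x + (blinfun_scaleR_left (g x) o\<^sub>L f' x))) (at x)"
      using f g by (auto intro!: derivative_eq_intros simp: blinfun.bilinear_simps)
  qed
  moreover have "continuous_on U (\<lambda>x. f x *\<^sub>R g' x + (blinfun_scaleR_left (g x) o\<^sub>L f' x))"
    by (intro continuous_intros c f g bounded_linear.continuous_on[OF bounded_linear_blinfun_scaleR_left])
  ultimately show ?thesis
    unfolding C1_map_on_def
    by (intro exI[of _ "\<lambda>x. f x *\<^sub>R g' x + (blinfun_scaleR_left (g x) o\<^sub>L f' x)"] conjI)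
qed

lemma C1_map_on_mult:
  fixes f g :: "'a::real_normed_vector \<Rightarrow> real"
  shows "C1_map_on U f \<Longrightarrow> C1_map_on U g \<Longrightarrow> C1_map_on U (\<lambda>x. f x * g x)"
  using C1_map_on_scaleR[of U f g] by simp

lemma C1_map_on_inverse:
  fixes f :: "'a::real_normed_vector \<Rightarrow> real"
  assumes "C1_map_on U f" "\<And>x. x \<in> U \<Longrightarrow> f x \<noteq> 0"
  shows "C1_map_on U (\<lambda>x. inverse (f x))"
proof -
  obtain f' where f: "\<forall>x\<in>U. (f has_derivative blinfun_apply (f' x)) (at x)" "continuous_on U f'"
    using assms unfolding C1_map_on_def by blast
  show ?thesis
    unfolding C1_map_on_def
    by (rule exI[of _ "\<lambda>x. - (inverse (f x) * inverse (f x)) *\<^sub>R f' x"])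
      (use f assms(2) C1_map_on_imp_continuous_on[OF assms(1)] in
        \<open>auto simp: blinfun.bilinear_simps intro!: derivative_eq_intros continuous_intros\<close>)
qed

lemma C1_map_on_divide:
  fixes f g :: "'a::real_normed_vector \<Rightarrow> real"
  shows "C1_map_on U f \<Longrightarrow> C1_map_on U g \<Longrightarrow> (\<And>x. x \<in> U \<Longrightarrow> g x \<noteq> 0) \<Longrightarrow>
    C1_map_on U (\<lambda>x. f x / g x)"
  unfolding divide_inverse by (intro C1_map_on_mult C1_map_on_inverse)

lemma C1_map_on_sqrt:
  fixes f :: "'a::real_normed_vector \<Rightarrow> real"
  assumes "C1_map_on U f" "\<And>x. x \<in> U \<Longrightarrow> 0 < f x"
  shows "C1_map_on U (\<lambda>x. sqrt (f x))"
proof -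
  obtain f' where f: "\<forall>x\<in>U. (f has_derivative blinfun_apply (f' x)) (at x)" "continuous_on U f'"
    using assms unfolding C1_map_on_def by blast
  have "\<forall>x\<in>U. ((\<lambda>x. sqrt (f x)) has_derivative
      blinfun_apply ((inverse (sqrt (f x)) / 2) *\<^sub>R f' x)) (at x)"
  proof
    fix x assume "x \<in> U"
    then show "((\<lambda>x. sqrt (f x)) has_derivative
        blinfun_apply ((inverse (sqrt (f x)) / 2) *\<^sub>R f' x)) (at x)"
      using f assms(2)[of x] by (auto simp: blinfun.bilinear_simps intro!: derivative_eq_intros)
  qed
  moreover have "continuous_on U (\<lambda>x. (inverse (sqrt (f x)) / 2) *\<^sub>R f' x)"
    using f assms(2) C1_map_on_imp_continuous_on[OF assms(1)]
    by (intro continuous_intros) (auto dest: assms(2))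
  ultimately show ?thesis
    unfolding C1_map_on_def by (intro exI[of _ "\<lambda>x. (inverse (sqrt (f x)) / 2) *\<^sub>R f' x"] conjI)
qed

lemma C1_map_on_compose:
  assumes "C1_map_on U f" "C1_map_on V g" "f ` U \<subseteq> V"
  shows "C1_map_on U (\<lambda>x. g (f x))"
proof -
  obtain f' g' where f: "\<forall>x\<in>U. (f has_derivative blinfun_apply (f' x)) (at x)" "continuous_on U f'"
    and g: "\<forall>x\<in>V. (g has_derivative blinfun_apply (g' x)) (at x)" "continuous_on V g'"
    using assms unfolding C1_map_on_def by blast
  have c: "continuous_on U f"
    using assms by (auto intro: C1_map_on_imp_continuous_on)
  have "\<forall>x\<in>U. ((\<lambda>x. g (f x)) has_derivative blinfun_apply (g' (f x) o\<^sub>L f' x)) (at x)"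
  proof
    fix x assume "x \<in> U"
    then have "(f has_derivative f' x) (at x)" "(g has_derivative g' (f x)) (at (f x))"
      using f g assms(3) by auto
    then show "((\<lambda>x. g (f x)) has_derivative blinfun_apply (g' (f x) o\<^sub>L f' x)) (at x)"
      using has_derivative_compose[of f "f' x" x UNIV g "g' (f x)"]
      by (simp add: blinfun_compose.rep_eq o_def)
  qed
  moreover have "continuous_on U (\<lambda>x. g' (f x) o\<^sub>L f' x)"
    using continuous_on_compose2[OF g(2) c assms(3)] f(2)
    by (intro continuous_intros)
  ultimately show ?thesis
    unfolding C1_map_on_def by (intro exI[of _ "\<lambda>x. g' (f x) o\<^sub>L f' x"] conjI)
qed

text \<open>For the continuity of \<open>F_norm\<close>: induction on the index set reduces the
  maximum to binary ones.\<close>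

lemma continuous_on_Max_image:
  fixes f :: "'i \<Rightarrow> 'a::topological_space \<Rightarrow> real"
  assumes "finite I" "I \<noteq> {}" "\<And>i. i \<in> I \<Longrightarrow> continuous_on X (f i)"
  shows "continuous_on X (\<lambda>x. Max ((\<lambda>i. f i x) ` I))"
  using assms
proof (induction I rule: finite_ne_induct)
  case (insert i I)
  then show ?case by (auto intro!: continuous_intros)
qed simp

section \<open>Level sets of homogeneous functions in an orthant\<close>

text \<open>Coordinates outside \<open>J\<close> are left free. This makes the set open in the whole
  space, so derivatives can be taken there without restricting to a subspace.\<close>

definition orthant :: "'n::finite set \<Rightarrow> (real^'n) set" where
  "orthant J = {x. \<forall>t\<in>J. 0 < x $ t}"

lemma open_orthant: "open (orthant J)"
proof -
  have "open (\<Inter>t\<in>J. {x :: real^'n. 0 < x $ t})" if "finite J" for J :: "'n::finite set"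
    using that by (auto intro!: open_INT open_Collect_less continuous_intros)
  moreover have "orthant J = (\<Inter>t\<in>J. {x. 0 < x $ t})"
    by (auto simp: orthant_def)
  ultimately show ?thesis
    by simp
qed

lemma orthant_scaleR: "x \<in> orthant J \<Longrightarrow> 0 < s \<Longrightarrow> s *\<^sub>R x \<in> orthant J"
  by (auto simp: orthant_def)

lemma convex_orthant: "convex (orthant J)"
proof -
  have "orthant J = (\<Inter>t\<in>J. {x. 0 < axis t 1 \<bullet> x})"
    by (auto simp: orthant_def inner_axis')
  then show ?thesis
    by (simp add: convex_INT convex_halfspace_gt)
qed

text \<open>To be instantiated with \<open>W\<close> the range of \<open>metric_coords J\<close> and
  \<open>r\<close> the square root of the area, the root giving homogeneity of degree 1.
  \<open>r'_mono\<close> is strict monotonicity at the infinitesimal level; it yields the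
  definiteness of the norm.\<close>

locale cone_section =
  fixes J :: "('i::finite \<times> 'i \<times> 'i) set"
    and W :: "(real^('i \<times> 'i \<times> 'i)) set"
    and r :: "real^('i \<times> 'i \<times> 'i) \<Rightarrow> real"
    and r' :: "real^('i \<times> 'i \<times> 'i) \<Rightarrow> (real^('i \<times> 'i \<times> 'i)) \<Rightarrow>\<^sub>L real"
  assumes J_ne: "J \<noteq> {}"
    and W_subspace: "subspace W"
    and W_supp: "\<And>w t. w \<in> W \<Longrightarrow> t \<notin> J \<Longrightarrow> w $ t = 0"
    and r_deriv: "\<And>x. x \<in> orthant J \<Longrightarrow> (r has_derivative r' x) (at x)"
    and r'_cont: "continuous_on (orthant J) r'"
    and r_pos: "\<And>x. x \<in> orthant J \<Longrightarrow> 0 < r x"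
    and r_scale: "\<And>s x. 0 < s \<Longrightarrow> x \<in> orthant J \<Longrightarrow> r (s *\<^sub>R x) = s * r x"
    and r'_mono: "\<And>x v. x \<in> orthant J \<Longrightarrow> (\<And>t. t \<in> J \<Longrightarrow> v $ t \<le> 0) \<Longrightarrow> r' x v = 0 \<Longrightarrow>
      \<forall>t\<in>J. v $ t = 0"
begin

definition M where "M = {x \<in> W \<inter> orthant J. r x = 1}"

lemma C1_r: "C1_map_on (orthant J) r"
  unfolding C1_map_on_def using r_deriv r'_cont by blast

lemma r_cont: "continuous_on (orthant J) r"
  using C1_r by (rule C1_map_on_imp_continuous_on)

section \<open>Radial projection to the level set\<close>

lemma normalised_in_M:
  assumes "x \<in> W" "x \<in> orthant J"
  shows "inverse (r x) *\<^sub>R x \<in> M"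
proof -
  have "0 < inverse (r x)"
    using r_pos[OF assms(2)] by simp
  then show ?thesis
    using r_scale[OF _ assms(2), of "inverse (r x)"] assms subspace_scale[OF W_subspace]
    by (simp add: M_def orthant_scaleR)
qed

text \<open>The line through \<open>A\<close> in direction \<open>v\<close>, projected radially to
  the level set. It provides curves with a prescribed tangent vector and, for
  \<open>v = B - A\<close>, a shortest curve from \<open>A\<close> to \<open>B\<close>.\<close>

definition ray where "ray A v s = inverse (r (A + s *\<^sub>R v)) *\<^sub>R (A + s *\<^sub>R v)"

text \<open>The velocity of \<open>ray A v\<close> by the product rule. At \<open>s = 0\<close> it
  equals \<open>v\<close> as soon as \<open>r A = 1\<close> and \<open>r' A v = 0\<close>.\<close>

definition ray' where
  "ray' A v s = inverse (r (A + s *\<^sub>R v)) *\<^sub>R v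
     - (r' (A + s *\<^sub>R v) v / (r (A + s *\<^sub>R v))\<^sup>2) *\<^sub>R (A + s *\<^sub>R v)"

lemma ray_deriv:
  assumes "A + s *\<^sub>R v \<in> orthant J"
  shows "(ray A v has_vector_derivative ray' A v s) (at s within T)"
proof -
  have 1: "((\<lambda>s. A + s *\<^sub>R v) has_vector_derivative v) (at s within T)"
    by (auto intro!: derivative_eq_intros)
  have "((\<lambda>s. r (A + s *\<^sub>R v)) has_real_derivative r' (A + s *\<^sub>R v) v) (at s within T)"
    using vector_derivative_diff_chain_within[OF 1, of r "r' (A + s *\<^sub>R v)"]
      has_derivative_at_withinI[OF r_deriv[OF assms]]
    by (simp add: o_def has_real_derivative_iff_has_vector_derivative)
  then have 2: "((\<lambda>s. inverse (r (A + s *\<^sub>R v))) has_real_derivative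
      - (r' (A + s *\<^sub>R v) v / (r (A + s *\<^sub>R v))\<^sup>2)) (at s within T)"
    using r_pos[OF assms]
    by (auto intro!: derivative_eq_intros simp: power2_eq_square divide_simps)
  show ?thesis
    unfolding ray_def ray'_def
    by (rule has_vector_derivative_eq_rhs[OF has_vector_derivative_scaleR[OF 2 1]]) simp
qed

lemma ray'_cont:
  assumes "\<And>s. s \<in> T \<Longrightarrow> A + s *\<^sub>R v \<in> orthant J"
  shows "continuous_on T (ray' A v)"
proof -
  have "(\<lambda>s. A + s *\<^sub>R v) ` T \<subseteq> orthant J"
    using assms by auto
  note c = continuous_on_compose2[OF r_cont _ this] continuous_on_compose2[OF r'_cont _ this]
  have "r (A + s *\<^sub>R v) \<noteq> 0" if "s \<in> T" for s
    using r_pos[OF assms[OF that]] by simp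
  then show ?thesis
    unfolding ray'_def by (intro continuous_intros c) auto
qed

lemma ray_in_M:
  assumes "A \<in> W" "v \<in> W" "A + s *\<^sub>R v \<in> orthant J"
  shows "ray A v s \<in> M"
  unfolding ray_def using W_subspace assms
  by (intro normalised_in_M) (simp_all add: subspace_add subspace_scale)

text \<open>Along a curve in \<open>M\<close> the function \<open>r\<close> is constant, so its
  derivative kills the velocity, and the difference quotients stay in the closed subspace
  \<open>W\<close>. Conversely, if \<open>v\<close> lies in \<open>W\<close> and
  \<open>r' A v = 0\<close>, the projected line through \<open>A\<close> has velocity
  \<open>v\<close> at 0.\<close>

lemma tangent_space_M:
  assumes "A \<in> M"
  shows "tangent_space M A = {v \<in> W. r' A v = 0}"
proof (intro equalityI subsetI)
  have A: "A \<in> W" "A \<in> orthant J" "r A = 1"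
    using assms by (auto simp: M_def)
  {
    fix v assume "v \<in> tangent_space M A"
    then obtain \<epsilon> c where c: "0 < \<epsilon>" "c ` {-\<epsilon><..<\<epsilon>} \<subseteq> M" "c 0 = A"
        "(c has_vector_derivative v) (at 0)"
      unfolding tangent_space_def mem_Collect_eq by (elim exE conjE) (rule that)
    let ?I = "{-\<epsilon><..<\<epsilon>}"
    have d: "(c has_vector_derivative v) (at 0 within ?I)"
      using c(4) by (rule has_vector_derivative_at_within)
    have rc: "((r \<circ> c) has_vector_derivative r' A v) (at 0 within ?I)"
      by (rule vector_derivative_diff_chain_within[OF d])
        (unfold c(3), rule has_derivative_at_withinI[OF r_deriv[OF A(2)]])
    \<comment> \<open>\<open>r\<close> along \<open>c\<close> is known to be 1 only on
      \<open>?I\<close>, so derivatives are compared within \<open>?I\<close>; as \<open>?I\<close>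
      is open, uniqueness of the derivative at 0 then applies.\<close>
    have "((\<lambda>_. 1) has_vector_derivative r' A v) (at 0 within ?I)"
    proof (rule has_vector_derivative_transform[OF _ _ rc])
      show "0 \<in> ?I" using c(1) by simp
      show "1 = (r \<circ> c) h" if "h \<in> ?I" for h
      proof -
        have "c h \<in> M" using c(2) that by blast
        then show ?thesis by (simp add: M_def)
      qed
    qed
    moreover have "at 0 within ?I = at 0"
      by (rule at_within_open) (use c(1) in auto)
    ultimately have "r' A v = 0"
      using vector_derivative_unique_at has_vector_derivative_const by metis
    moreover have "v \<in> W"
    proof -
      have lim: "((\<lambda>h. (1/h) *\<^sub>R (c h - c 0)) \<longlongrightarrow> v) (at 0)"
      proof (rule LIM_zero_cancel, rule tendsto_norm_zero_cancel)
        have "((\<lambda>h. norm ((c h - c 0 - h *\<^sub>R v) /\<^sub>R norm h)) \<longlongrightarrow> 0) (at 0)"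
          by (rule tendsto_norm_zero)
            (use c(4) in \<open>simp add: has_vector_derivative_def has_derivative_at_within\<close>)
        moreover have "\<forall>\<^sub>F h in at 0. norm ((c h - c 0 - h *\<^sub>R v) /\<^sub>R norm h) =
            norm ((1/h) *\<^sub>R (c h - c 0) - v)"
        proof (rule eventually_mono[OF eventually_neq_at_within])
          fix h :: real assume "h \<noteq> 0"
          then have "(1/h) *\<^sub>R (c h - c 0) - v = (1/h) *\<^sub>R (c h - c 0 - h *\<^sub>R v)"
            by (simp add: scaleR_diff_right)
          then show "norm ((c h - c 0 - h *\<^sub>R v) /\<^sub>R norm h) = norm ((1/h) *\<^sub>R (c h - c 0) - v)"
            by (simp add: divide_inverse)
        qed
        ultimately show "((\<lambda>h. norm ((1/h) *\<^sub>R (c h - c 0) - v)) \<longlongrightarrow> 0) (at 0)"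
          by (rule Lim_transform_eventually)
      qed
      have ev: "\<forall>\<^sub>F h in at 0. (1/h) *\<^sub>R (c h - c 0) \<in> W"
      proof -
        have "\<forall>\<^sub>F h in at 0. h \<in> ?I"
          using c(1) by (intro eventually_at_in_open') auto
        then show ?thesis
        proof eventually_elim
          case (elim h)
          then have "c h \<in> M" "c 0 \<in> M"
            using c(2,3) assms by blast+
          then have "c h \<in> W" "c 0 \<in> W"
            by (auto simp: M_def)
          then show ?case
            by (intro subspace_scale subspace_diff W_subspace)
        qed
      qed
      show ?thesis
        by (rule Lim_in_closed_set[OF closed_subspace[OF W_subspace] ev _ lim]) simp
    qed
    ultimately show "v \<in> {v \<in> W. r' A v = 0}" by simp
  }
  {
    fix v assume "v \<in> {v \<in> W. r' A v = 0}"
    then have v: "v \<in> W" "r' A v = 0" by auto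
    have "open ((\<lambda>s::real. A + s *\<^sub>R v) -` orthant J)"
      by (intro open_vimage open_orthant continuous_intros)
    moreover have "0 \<in> (\<lambda>s::real. A + s *\<^sub>R v) -` orthant J"
      using A by simp
    ultimately obtain \<epsilon> where \<epsilon>: "0 < \<epsilon>" "ball 0 \<epsilon> \<subseteq> (\<lambda>s::real. A + s *\<^sub>R v) -` orthant J"
      by (meson openE)
    then have in_orthant: "A + s *\<^sub>R v \<in> orthant J" if "s \<in> {-\<epsilon><..<\<epsilon>}" for s
      using that by (force simp: ball_def dist_real_def)
    have "ray A v ` {-\<epsilon><..<\<epsilon>} \<subseteq> M"
      using in_orthant A(1) v(1) by (auto intro: ray_in_M)
    moreover have "ray A v C1_differentiable_on {-\<epsilon><..<\<epsilon>}"
      unfolding C1_differentiable_on_def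
      by (intro exI[of _ "ray' A v"] conjI ballI ray_deriv ray'_cont in_orthant)
    moreover have "ray A v 0 = A" "(ray A v has_vector_derivative v) (at 0)"
      using ray_deriv[of A 0 v UNIV] A v(2) by (auto simp: ray_def ray'_def)
    ultimately show "v \<in> tangent_space M A"
      unfolding tangent_space_def using \<epsilon>(1)
      by (intro CollectI exI[of _ \<epsilon>] exI[of _ "ray A v"] conjI)
  }
qed

section \<open>The norm on each tangent space and its continuity\<close>

lemma F_norm_ge: "t \<in> J \<Longrightarrow> v $ t / A $ t \<le> F_norm J (A, v)"
  unfolding F_norm_def by (auto intro!: Max_ge)

lemma F_norm_attained: obtains t where "t \<in> J" "F_norm J (A, v) = v $ t / A $ t"
proof -
  have "F_norm J (A, v) \<in> (\<lambda>t. v $ t / A $ t) ` J"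
    unfolding F_norm_def using J_ne by (auto intro!: Max_in)
  then show ?thesis using that by auto
qed

text \<open>If the maximum is at most 0, no coordinate in \<open>J\<close> is positive, so
  \<open>r'_mono\<close> makes those coordinates vanish, and \<open>W_supp\<close> takes care of the
  others. Homogeneity and convexity hold for each quotient and pass to the maximum.\<close>

lemma minkowski_norm_on_M:
  assumes "A \<in> M"
  shows "minkowski_norm_on (tangent_space M A) (\<lambda>v. F_norm J (A, v))"
proof -
  have A: "A \<in> W" "A \<in> orthant J" "r A = 1"
    using assms by (auto simp: M_def)
  have Apos: "0 < A $ t" if "t \<in> J" for t
    using A(2) that by (auto simp: orthant_def)
  have zero: "v = 0" if "v \<in> tangent_space M A" "F_norm J (A, v) \<le> 0" for v
  proof -
    have "v $ t \<le> 0" if "t \<in> J" for t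
    proof -
      have "v $ t / A $ t \<le> 0"
        using F_norm_ge[OF that, of v A] \<open>F_norm J (A, v) \<le> 0\<close> by simp
      then show ?thesis
        using Apos[OF that] by (simp add: divide_le_0_iff)
    qed
    then have "\<forall>t\<in>J. v $ t = 0"
      using that(1) by (intro r'_mono[OF A(2)]) (auto simp: tangent_space_M[OF assms])
    then show "v = 0"
      using W_supp[of v] that(1) by (auto simp: vec_eq_iff tangent_space_M[OF assms])
  qed
  have F0: "F_norm J (A, 0) = 0"
    using F_norm_attained[of A 0] by auto
  \<comment> \<open>A negative value would force \<open>v = 0\<close> by \<open>zero\<close>, where
    the value is 0.\<close>
  have nonneg: "0 \<le> F_norm J (A, v)" if "v \<in> tangent_space M A" for v
    using zero[OF that] F0 by (cases "F_norm J (A, v) \<le> 0") auto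
  have "subspace (tangent_space M A)"
    unfolding tangent_space_M[OF assms] using W_subspace
    by (auto simp: subspace_def blinfun.bilinear_simps)
  moreover have "F_norm J (A, s *\<^sub>R v) = s * F_norm J (A, v)" if "0 < s" for s v
  proof (rule antisym)
    obtain t where "t \<in> J" "F_norm J (A, s *\<^sub>R v) = (s *\<^sub>R v) $ t / A $ t"
      by (rule F_norm_attained)
    then show "F_norm J (A, s *\<^sub>R v) \<le> s * F_norm J (A, v)"
      using mult_left_mono[OF F_norm_ge[of t v A], of s] that by simp
    obtain t where "t \<in> J" "F_norm J (A, v) = v $ t / A $ t"
      by (rule F_norm_attained)
    then show "s * F_norm J (A, v) \<le> F_norm J (A, s *\<^sub>R v)"
      using F_norm_ge[of t "s *\<^sub>R v" A] by simp
  qed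
  moreover have "F_norm J (A, s *\<^sub>R v + (1 - s) *\<^sub>R w) \<le> s * F_norm J (A, v) + (1 - s) * F_norm J (A, w)"
    if "s \<in> {0..1}" for s v w
  proof -
    obtain t where t: "t \<in> J"
      "F_norm J (A, s *\<^sub>R v + (1 - s) *\<^sub>R w) = (s *\<^sub>R v + (1 - s) *\<^sub>R w) $ t / A $ t"
      by (rule F_norm_attained)
    have "s * (v $ t / A $ t) + (1 - s) * (w $ t / A $ t) \<le> s * F_norm J (A, v) + (1 - s) * F_norm J (A, w)"
      using that by (intro add_mono mult_left_mono F_norm_ge t) auto
    then show ?thesis
      unfolding t by (simp add: add_divide_distrib)
  qed
  ultimately show ?thesis
    unfolding minkowski_norm_on_def
    using nonneg F0 by (intro conjI ballI allI impI iffI zero) simp_all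
qed

text \<open>Stated on a set larger than the tangent bundle, so that it also gives integrability
  along curves without checking that their velocities are tangent.\<close>

lemma F_norm_continuous_on:
  "continuous_on (orthant J \<times> UNIV) (F_norm J)"
proof -
  have "continuous_on (orthant J \<times> UNIV) (\<lambda>p. snd p $ t / fst p $ t)" if "t \<in> J" for t
  proof (intro continuous_on_divide continuous_on_component continuous_on_fst continuous_on_snd
      continuous_on_id ballI)
    show "fst p $ t \<noteq> 0" if "p \<in> orthant J \<times> UNIV" for p
      using that \<open>t \<in> J\<close> by (cases p) (auto simp: orthant_def)
  qed
  then have "continuous_on (orthant J \<times> UNIV) (\<lambda>p. Max ((\<lambda>t. snd p $ t / fst p $ t) ` J))"
    using J_ne by (intro continuous_on_Max_image) auto
  then show ?thesis
    by (simp add: F_norm_def case_prod_beta)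
qed

text \<open>Multiplication of \<open>x\<close> by \<open>g x\<close> carries the level set
  \<open>r = 1\<close> to the slice \<open>l = 1\<close> of \<open>W\<close>. The whole orthant
  serves as chart domain at every point; only the translation that makes the slice linear depends on
  the point.\<close>

lemma embedded_submanifold_M: "embedded_submanifold M"
proof -
  define l :: "real^('i \<times> 'i \<times> 'i) \<Rightarrow> real" where "l x = (\<Sum>t\<in>J. x $ t)" for x
  \<comment> \<open>Of degree 0, so \<open>g\<close> takes the same value at \<open>x\<close> and at
    its rescaling by \<open>g x\<close>, and division by \<open>g\<close> inverts the rescaling.
    Moreover \<open>l (g x *\<^sub>R x) = r x\<close>.\<close>
  define g where "g x = r x / l x" for x
  define L where "L = {x \<in> W. l x = 0}"
  let ?Q = "orthant J"
  have l_add: "l (x + y) = l x + l y" and l_diff: "l (x - y) = l x - l y"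
    and l_scale: "l (s *\<^sub>R x) = s * l x" for x y s
    by (auto simp: l_def sum.distrib sum_subtractf sum_distrib_left)
  have l_pos: "0 < l x" if "x \<in> ?Q" for x
    unfolding l_def using that J_ne by (intro sum_pos) (auto simp: orthant_def)
  have g_pos: "0 < g x" if "x \<in> ?Q" for x
    using l_pos r_pos that by (simp add: g_def)
  have g_scale: "g (s *\<^sub>R x) = g x" if "x \<in> ?Q" "0 < s" for s x
    using that by (simp add: g_def r_scale l_scale)
  have "C1_map_on ?Q l"
    unfolding l_def by (intro C1_map_on_sum C1_map_on_bounded_linear bounded_linear_vec_nth) auto
  then have C1_g: "C1_map_on ?Q g"
    unfolding g_def using l_pos by (intro C1_map_on_divide C1_r) (auto simp: less_imp_neq[symmetric])
  have L: "subspace L"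
    using W_subspace by (auto simp: L_def subspace_def l_add l_scale) (simp add: l_def)
  have "\<exists>U V \<phi> \<psi> L'. open U \<and> x0 \<in> U \<and> open V \<and> homeomorphism U V \<phi> \<psi> \<and>
        C1_map_on U \<phi> \<and> C1_map_on V \<psi> \<and>
        subspace (L' :: (real^('i \<times> 'i \<times> 'i)) set) \<and> dim L' = dim L \<and> \<phi> ` (M \<inter> U) = V \<inter> L'" if "x0 \<in> M" for x0
  proof -
    have x0: "x0 \<in> W" "x0 \<in> ?Q" "r x0 = 1"
      using that by (auto simp: M_def)
    \<comment> \<open>The image of \<open>x0\<close> in the slice; subtracting it turns the affine
      slice into the linear subspace \<open>L\<close>.\<close>
    define y0 where "y0 = g x0 *\<^sub>R x0"
    have y0: "y0 \<in> W" "l y0 = 1"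
      using x0 l_pos[OF x0(2)] by (auto simp: y0_def l_scale g_def subspace_scale[OF W_subspace])
    define \<phi> where "\<phi> x = g x *\<^sub>R x - y0" for x
    define \<psi> where "\<psi> y = inverse (g (y + y0)) *\<^sub>R (y + y0)" for y
    define V where "V = (\<lambda>y. y + y0) -` ?Q"
    have "open V"
      unfolding V_def by (intro open_vimage open_orthant continuous_intros)
    have \<phi>V: "\<phi> x \<in> V" and \<psi>\<phi>: "\<psi> (\<phi> x) = x" and l\<phi>: "l (\<phi> x) = r x - 1" if "x \<in> ?Q" for x
      using that g_pos[OF that] l_pos[OF that]
      by (auto simp: \<phi>_def \<psi>_def V_def g_scale orthant_scaleR l_diff l_scale y0) (simp add: g_def)
    have \<psi>Q: "\<psi> y \<in> ?Q" and \<phi>\<psi>: "\<phi> (\<psi> y) = y" and r\<psi>: "r (\<psi> y) = l y + 1" if "y \<in> V" for y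
    proof -
      have Q: "y + y0 \<in> ?Q" using that by (simp add: V_def)
      show "\<psi> y \<in> ?Q" "\<phi> (\<psi> y) = y" "r (\<psi> y) = l y + 1"
        using g_pos[OF Q] l_pos[OF Q] r_pos[OF Q] Q
        by (auto simp: \<phi>_def \<psi>_def g_scale r_scale orthant_scaleR) (simp add: g_def l_add y0)
    qed
    have "C1_map_on ?Q (\<lambda>x. g x *\<^sub>R x + (- y0))"
      by (intro C1_map_on_add C1_map_on_scaleR C1_g C1_map_on_const C1_map_on_ident)
    then have C1_\<phi>: "C1_map_on ?Q \<phi>"
      unfolding \<phi>_def by simp
    have "C1_map_on ?Q (\<lambda>x. inverse (g x) *\<^sub>R x)"
      using g_pos by (intro C1_map_on_scaleR C1_map_on_inverse C1_g C1_map_on_ident) (auto simp: less_imp_neq[symmetric])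
    then have "C1_map_on V (\<lambda>y. inverse (g (y + y0)) *\<^sub>R (y + y0))"
      by (rule C1_map_on_compose[rotated])
        (auto simp: V_def intro!: C1_map_on_add C1_map_on_const C1_map_on_ident)
    then have C1_\<psi>: "C1_map_on V \<psi>"
      unfolding \<psi>_def .
    have "homeomorphism ?Q V \<phi> \<psi>"
      by (rule homeomorphismI)
        (use C1_\<phi> C1_\<psi> \<phi>V \<psi>\<phi> \<psi>Q \<phi>\<psi> in \<open>auto intro: C1_map_on_imp_continuous_on\<close>)
    moreover have "\<phi> ` (M \<inter> ?Q) = V \<inter> L"
    proof (intro equalityI subsetI)
      fix y assume "y \<in> \<phi> ` (M \<inter> ?Q)"
      then obtain x where "x \<in> W" "x \<in> ?Q" "r x = 1" "y = \<phi> x"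
        by (auto simp: M_def)
      then show "y \<in> V \<inter> L"
        using \<phi>V[of x] l\<phi>[of x] y0(1)
        by (auto simp: L_def \<phi>_def intro!: subspace_diff subspace_scale W_subspace)
    next
      fix y assume y: "y \<in> V \<inter> L"
      then have "\<psi> y \<in> W"
        using y0(1) by (auto simp: L_def \<psi>_def intro!: subspace_add subspace_scale W_subspace)
      then have "\<psi> y \<in> M \<inter> ?Q"
        using \<psi>Q[of y] r\<psi>[of y] y by (auto simp: M_def L_def)
      then show "y \<in> \<phi> ` (M \<inter> ?Q)"
        using \<phi>\<psi>[of y] y by (metis IntD1 imageI)
    qed
    ultimately have "open ?Q \<and> x0 \<in> ?Q \<and> open V \<and> homeomorphism ?Q V \<phi> \<psi> \<and>
        C1_map_on ?Q \<phi> \<and> C1_map_on V \<psi> \<and>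
        subspace L \<and> dim L = dim L \<and> \<phi> ` (M \<inter> ?Q) = V \<inter> L"
      using open_orthant x0(2) \<open>open V\<close> C1_\<phi> C1_\<psi> L by simp
    then show ?thesis
      by (intro exI)
  qed
  then show ?thesis
    unfolding embedded_submanifold_def by blast
qed

lemma finsler_structure_on_M: "finsler_structure_on M (F_norm J)"
proof -
  have "tangent_bundle M \<subseteq> orthant J \<times> UNIV"
    by (auto simp: tangent_bundle_def M_def)
  then show ?thesis
    unfolding finsler_structure_on_def
    using embedded_submanifold_M minkowski_norm_on_M F_norm_continuous_on continuous_on_subset by blast
qed

end

section \<open>Lengths of curves\<close>

text \<open>All three facts are proved on \<open>{0..p m}\<close> by induction on \<open>m\<close>,
  adding one piece at a time. Inside a piece \<open>w\<close> agrees with the continuous derivative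
  \<open>D\<close> of that piece. The second factor \<open>UNIV\<close> in the domain of
  \<open>G\<close> leaves the velocities unconstrained.\<close>

lemma piecewise_C1_curve_pieces:
  fixes c :: "real \<Rightarrow> 'a::real_normed_vector" and G :: "'a \<times> 'a \<Rightarrow> real"
  defines "w \<equiv> \<lambda>t. vector_derivative c (at t within {0..1})"
  assumes "piecewise_C1_curve c" and G: "continuous_on (Q \<times> UNIV) G" and c: "c ` {0..1} \<subseteq> Q"
  shows "continuous_on {0..1} c"
    and "\<exists>S. finite S \<and> (\<forall>t\<in>{0<..<1} - S. (c has_vector_derivative w t) (at t))"
    and "(\<lambda>t. G (c t, w t)) integrable_on {0..1}"
proof -
  obtain n :: nat and p where p: "p 0 = 0" "p n = 1" "\<And>m. m < n \<Longrightarrow> p m < p (Suc m)"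
    and pieces: "\<And>m. m < n \<Longrightarrow> \<exists>D. continuous_on {p m..p (Suc m)} D \<and>
        (\<forall>t\<in>{p m..p (Suc m)}. (c has_vector_derivative D t) (at t within {p m..p (Suc m)}))"
    using assms(2) unfolding piecewise_C1_curve_def by blast
  have p_mono: "p m \<le> p k" if "m \<le> k" "k \<le> n" for m k
    using that
  proof (induction k rule: dec_induct)
    case (step k)
    then show ?case using p(3)[of k] by simp
  qed simp
  have "continuous_on {0..p m} c \<and>
      (\<exists>S. finite S \<and> (\<forall>t\<in>{0<..<p m} - S. (c has_vector_derivative w t) (at t))) \<and>
      (\<lambda>t. G (c t, w t)) integrable_on {0..p m}" if "m \<le> n" for m
    using that
  proof (induction m)
    case 0
    show ?case
      using integrable_on_refl[of _ "0::real"] by (auto simp: p(1))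
  next
    case (Suc m)
    let ?a = "p m" and ?b = "p (Suc m)"
    have ab: "0 \<le> ?a" "?a < ?b" "?b \<le> 1"
      using p_mono[of 0 m] p_mono[of "Suc m" n] p(1,2) p(3)[of m] Suc.prems by auto
    obtain S where IH: "continuous_on {0..?a} c" "finite S"
      "\<And>t. t \<in> {0<..<?a} - S \<Longrightarrow> (c has_vector_derivative w t) (at t)"
      "(\<lambda>t. G (c t, w t)) integrable_on {0..?a}"
      using Suc by auto
    obtain D where D: "continuous_on {?a..?b} D"
      "\<And>t. t \<in> {?a..?b} \<Longrightarrow> (c has_vector_derivative D t) (at t within {?a..?b})"
      using pieces[of m] Suc.prems by auto
    have D_at: "(c has_vector_derivative D t) (at t)" and w: "w t = D t" if "t \<in> {?a<..<?b}" for t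
    proof -
      have "at t within {?a..?b} = at t" "at t within {0..1} = at t"
        using that ab by (auto intro!: at_within_Icc_at)
      then show "(c has_vector_derivative D t) (at t)" "w t = D t"
        using D(2)[of t] that by (auto simp: w_def vector_derivative_at)
    qed
    have cont: "continuous_on {?a..?b} c"
      by (rule continuous_on_vector_derivative) (rule D(2))
    have un: "{0..?b} = {0..?a} \<union> {?a..?b}"
      using ab by auto
    have "continuous_on {0..?b} c"
      unfolding un by (intro continuous_on_closed_Un IH(1) cont) auto
    moreover have "\<exists>S. finite S \<and> (\<forall>t\<in>{0<..<?b} - S. (c has_vector_derivative w t) (at t))"
    \<comment> \<open>The point where the new piece is attached may be a corner.\<close>
    proof (intro exI[of _ "insert ?a S"] conjI ballI)
      fix t assume t: "t \<in> {0<..<?b} - insert ?a S"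
      show "(c has_vector_derivative w t) (at t)"
      proof (cases "t < ?a")
        case True
        then show ?thesis using IH(3)[of t] t by auto
      next
        case False
        then have "t \<in> {?a<..<?b}" using t by auto
        then show ?thesis using D_at w by metis
      qed
    qed (use IH(2) in auto)
    moreover have "(\<lambda>t. G (c t, w t)) integrable_on {0..?b}"
    proof (rule Henstock_Kurzweil_Integration.integrable_combine[OF ab(1) less_imp_le[OF ab(2)] IH(4)])
      have "continuous_on {?a..?b} (\<lambda>t. G (c t, D t))"
        by (rule continuous_on_compose2[OF G])
          (use cont D(1) c ab in \<open>auto intro!: continuous_on_Pair simp: image_subset_iff\<close>)
      then have "(\<lambda>t. G (c t, D t)) integrable_on {?a..?b}"
        by (rule integrable_continuous_real)
      \<comment> \<open>The two integrands may differ only at the end points of the piece.\<close>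
      then show "(\<lambda>t. G (c t, w t)) integrable_on {?a..?b}"
        by (rule integrable_spike_finite[of "{?a, ?b}", rotated 2]) (auto simp: w)
    qed
    ultimately show ?case by blast
  qed
  from this[of n] show "continuous_on {0..1} c"
    "\<exists>S. finite S \<and> (\<forall>t\<in>{0<..<1} - S. (c has_vector_derivative w t) (at t))"
    "(\<lambda>t. G (c t, w t)) integrable_on {0..1}"
    by (auto simp: p(2))
qed

context cone_section
begin

text \<open>The integrand is the derivative of the logarithm of a coordinate of \<open>c\<close>.
  The fundamental theorem applies because that logarithm is continuous and differentiable off
  finitely many points.\<close>

lemma log_component_integral:
  assumes "c \<in> curves_from_to M A B" "t \<in> J"
  shows "((\<lambda>s. vector_derivative c (at s within {0..1}) $ t / c s $ t)
    has_integral ln (B $ t / A $ t)) {0..1}"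
proof -
  let ?w = "\<lambda>s. vector_derivative c (at s within {0..1})"
  have c: "piecewise_C1_curve c" "c ` {0..1} \<subseteq> M" "c 0 = A" "c 1 = B"
    using assms(1) by (auto simp: curves_from_to_def)
  have pos: "0 < c s $ t" if "s \<in> {0..1}" for s
  proof -
    have "c s \<in> M" using c(2) that by blast
    then show ?thesis using assms(2) by (auto simp: M_def orthant_def)
  qed
  \<comment> \<open>The zero function stands in for \<open>G\<close>: what is drawn from the lemma
    is continuity and differentiability off the corners.\<close>
  note pieces = piecewise_C1_curve_pieces[OF c(1) continuous_on_const[of _ 0] c(2)]
  obtain S where S: "finite S" "\<And>s. s \<in> {0<..<1} - S \<Longrightarrow> (c has_vector_derivative ?w s) (at s)"
    using pieces(2) by auto
  have "((\<lambda>s. ln (c s $ t)) has_vector_derivative ?w s $ t / c s $ t) (at s)"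
    if "s \<in> {0<..<1} - S" for s
  proof -
    have "((\<lambda>s. c s $ t) has_real_derivative ?w s $ t) (at s)"
      using bounded_linear.has_vector_derivative[OF bounded_linear_vec_nth S(2)[OF that]]
      by (simp add: has_real_derivative_iff_has_vector_derivative)
    from DERIV_chain2[OF DERIV_ln_divide this] pos[of s] that show ?thesis
      by (simp add: has_real_derivative_iff_has_vector_derivative)
  qed
  moreover have "continuous_on {0..1} (\<lambda>s. ln (c s $ t))"
    by (intro continuous_on_ln continuous_on_component pieces(1)) (use pos in force)
  ultimately have "((\<lambda>s. ?w s $ t / c s $ t) has_integral ln (c 1 $ t) - ln (c 0 $ t)) {0..1}"
    by (intro fundamental_theorem_of_calculus_interior_strong[OF S(1)]) auto
  then show ?thesis
    using pos[of 0] pos[of 1] by (simp add: c ln_div)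
qed

section \<open>The distance as an infimum of lengths\<close>

lemma eta_eq: "eta J A B = ln (F_norm J (A, B))"
  by (simp add: eta_def F_norm_def)

text \<open>Fix the coordinate that realises the maximum in \<open>eta\<close>. Its logarithmic
  derivative along \<open>c\<close> is bounded by \<open>F_norm\<close> and integrates to exactly
  \<open>eta J A B\<close>.\<close>

lemma eta_le_length:
  assumes "c \<in> curves_from_to M A B"
  shows "eta J A B \<le> finsler_length (F_norm J) c"
proof -
  obtain t where t: "t \<in> J" "F_norm J (A, B) = B $ t / A $ t"
    by (rule F_norm_attained)
  have c: "piecewise_C1_curve c" "c ` {0..1} \<subseteq> orthant J"
    using assms by (auto simp: curves_from_to_def M_def)
  have "(\<lambda>s. F_norm J (c s, vector_derivative c (at s within {0..1}))) integrable_on {0..1}"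
    by (rule piecewise_C1_curve_pieces(3)[OF c(1) F_norm_continuous_on c(2)])
  then have "ln (B $ t / A $ t) \<le> finsler_length (F_norm J) c"
    unfolding finsler_length_def
    by (intro has_integral_le[OF log_component_integral[OF assms t(1)]])
      (auto simp: has_integral_integral[symmetric] intro: F_norm_ge t(1))
  then show ?thesis
    by (simp add: eta_eq t)
qed

text \<open>Normalising multiplies all components by the same factor, so on the normalised segment the
  same component realises the maximum all the time.\<close>

lemma eta_attained:
  assumes "A \<in> M" "B \<in> M"
  obtains c where "c \<in> curves_from_to M A B" "finsler_length (F_norm J) c = eta J A B"
proof
  let ?v = "B - A"
  let ?c = "ray A ?v"
  have AB: "A \<in> W" "A \<in> orthant J" "r A = 1" "B \<in> W" "B \<in> orthant J" "r B = 1"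
    using assms by (auto simp: M_def)
  have Q: "A + s *\<^sub>R ?v \<in> orthant J" if "s \<in> {0..1}" for s
    using convexD_alt[OF convex_orthant AB(2,5), of s] that by (simp add: algebra_simps)
  have "?c ` {0..1} \<subseteq> M"
    using AB by (auto intro!: ray_in_M Q subspace_diff[OF W_subspace])
  moreover have "piecewise_C1_curve ?c"
    \<comment> \<open>A single piece, with partition points 0 and 1.\<close>
    unfolding piecewise_C1_curve_def
    by (intro exI[of _ "1::nat"] exI[of _ real])
      (auto intro!: exI[of _ "ray' A ?v"] ray_deriv ray'_cont Q)
  ultimately show curve: "?c \<in> curves_from_to M A B"
    using AB by (auto simp: curves_from_to_def ray_def)
  obtain t0 where t0: "t0 \<in> J" "F_norm J (A, B) = B $ t0 / A $ t0"
    by (rule F_norm_attained)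
  have "F_norm J (?c s, vector_derivative ?c (at s within {0..1})) =
      vector_derivative ?c (at s within {0..1}) $ t0 / ?c s $ t0" (is "?F = ?w $ t0 / _")
    if s: "s \<in> {0..1}" for s
  proof (rule antisym)
    let ?y = "A + s *\<^sub>R ?v"
    have w: "?w = ray' A ?v s"
      by (rule vector_derivative_within_closed_interval) (use s ray_deriv[OF Q] in auto)
    \<comment> \<open>The subtracted term, which comes from the normalisation, is the same for all
      \<open>t\<close>, so the comparison reduces to the unnormalised segment.\<close>
    have quot: "?w $ t / ?c s $ t = ?v $ t / ?y $ t - r' ?y ?v / r ?y" if "t \<in> J" for t
    proof -
      have "0 < ?y $ t" "0 < r ?y"
        using Q[OF s] r_pos[OF Q[OF s]] that by (auto simp: orthant_def)
      moreover have "(inverse \<rho> * a - d / \<rho>\<^sup>2 * b) / (inverse \<rho> * b) = a / b - d / \<rho>"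
        if "0 < b" "0 < \<rho>" for a b d \<rho> :: real
        using that by (simp add: field_simps power2_eq_square)
      ultimately show ?thesis
        unfolding w ray'_def ray_def
        by (simp only: vector_minus_component vector_scaleR_component real_scaleR_def)
    qed
    obtain t where t: "t \<in> J" "?F = ?w $ t / ?c s $ t"
      by (rule F_norm_attained)
    have pos: "0 < A $ t" "0 < A $ t0" "0 < ?y $ t" "0 < ?y $ t0"
      using Q[OF s] AB(2) t(1) t0(1) by (auto simp: orthant_def)
    have "B $ t / A $ t \<le> B $ t0 / A $ t0"
      using F_norm_ge[OF t(1), of B A] t0(2) by simp
    then have "B $ t * A $ t0 \<le> B $ t0 * A $ t"
      using pos by (simp add: divide_simps mult.commute)
    \<comment> \<open>With \<open>?y\<close> expanded, the terms in \<open>s\<close> cancel and the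
      difference of the two sides is exactly \<open>B $ t * A $ t0 - B $ t0 * A $ t\<close>.\<close>
    then have "?v $ t * ?y $ t0 \<le> ?v $ t0 * ?y $ t"
      by (simp add: algebra_simps)
    then have "?v $ t / ?y $ t \<le> ?v $ t0 / ?y $ t0"
      using pos(3,4) by (subst frac_le_eq) (auto simp: divide_le_0_iff)
    then show "?F \<le> ?w $ t0 / ?c s $ t0"
      unfolding t(2) quot[OF t(1)] quot[OF t0(1)] by simp
  qed (rule F_norm_ge[OF t0(1)])
  then have "((\<lambda>s. F_norm J (?c s, vector_derivative ?c (at s within {0..1})))
      has_integral ln (B $ t0 / A $ t0)) {0..1}"
    by (intro has_integral_eq[OF _ log_component_integral[OF curve t0(1)]]) simp
  then show "finsler_length (F_norm J) ?c = eta J A B"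
    unfolding finsler_length_def eta_eq t0(2) by (rule integral_unique)
qed

lemma eta_eq_INF_length:
  assumes "A \<in> M" "B \<in> M"
  shows "ereal (eta J A B) = (INF c\<in>curves_from_to M A B. ereal (finsler_length (F_norm J) c))"
proof (rule antisym)
  obtain c where "c \<in> curves_from_to M A B" "finsler_length (F_norm J) c = eta J A B"
    using eta_attained[OF assms] by blast
  then show "(INF c\<in>curves_from_to M A B. ereal (finsler_length (F_norm J) c)) \<le> ereal (eta J A B)"
    by (metis INF_lower)
qed (auto intro!: INF_greatest eta_le_length)

end

section \<open>The metrics of a triangulated surface\<close>

text \<open>The faces of a triangle are the hulls of subsets of its vertices, and the
  one-dimensional ones come from the three pairs. They belong to the complex because it is closed
  under faces, and are indexed because \<open>e\<close> is onto.\<close>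

lemma ex_face_triple:
  assumes \<T>: "simplicial_complex \<T>" and e: "bij_betw e UNIV (edges \<T>)" and f: "f \<in> faces \<T>"
  obtains i j k where "face_triple \<T> e f (i, j, k)"
proof -
  have "f \<in> \<T>" "2 simplex f"
    using f by (auto simp: faces_def)
  then obtain C where C: "\<not> affine_dependent C" "card C = 3" "f = convex hull C"
    by (auto simp: simplex_def)
  then obtain x y z where xyz: "C = {x, y, z}" "x \<noteq> y" "x \<noteq> z" "y \<noteq> z"
    by (auto simp: card_3_iff)
  \<comment> \<open>The hull of an affinely independent set has dimension one less than the number
    of points.\<close>
  have two: "1 simplex (convex hull c) \<longleftrightarrow> c = {x, y} \<or> c = {y, z} \<or> c = {x, z}" if "c \<subseteq> C" for c
  proof -
    have ind: "\<not> affine_dependent c"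
      using C(1) that affine_dependent_subset by blast
    have "card c = 2 \<Longrightarrow> c = {x, y} \<or> c = {y, z} \<or> c = {x, z}"
      using that unfolding xyz(1) card_2_iff by auto
    moreover have "1 simplex (convex hull c) \<longleftrightarrow> card c = 2"
    proof
      assume "1 simplex (convex hull c)"
      then have "aff_dim (convex hull c) = 1"
        by (rule aff_dim_simplex)
      then show "card c = 2"
        using aff_dim_affine_independent[OF ind] by (simp add: aff_dim_convex_hull)
    next
      assume "card c = 2"
      then show "1 simplex (convex hull c)"
        using ind by (auto simp: simplex_def)
    qed
    ultimately show ?thesis
      using xyz by auto
  qed
  have face: "\<sigma> face_of f \<longleftrightarrow> (\<exists>c\<subseteq>C. \<sigma> = convex hull c)" for \<sigma>
    unfolding C(3) using face_of_convex_hull_affine_independent[OF C(1)] by blast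
  have in_\<T>: "\<sigma> \<in> \<T>" if "\<sigma> face_of f" for \<sigma>
    using \<T> \<open>f \<in> \<T>\<close> that unfolding simplicial_complex_def by blast
  have "{\<sigma>\<in>edges \<T>. \<sigma> face_of f} = {convex hull {x, y}, convex hull {y, z}, convex hull {x, z}}"
  proof (intro equalityI subsetI)
    fix \<sigma> assume "\<sigma> \<in> {\<sigma>\<in>edges \<T>. \<sigma> face_of f}"
    then obtain c where "c \<subseteq> C" "\<sigma> = convex hull c" "1 simplex \<sigma>"
      using face by (auto simp: edges_def)
    moreover from this have "c = {x, y} \<or> c = {y, z} \<or> c = {x, z}"
      using two by simp
    ultimately show "\<sigma> \<in> {convex hull {x, y}, convex hull {y, z}, convex hull {x, z}}"
      by (elim disjE) simp_all
  next
    fix \<sigma> assume "\<sigma> \<in> {convex hull {x, y}, convex hull {y, z}, convex hull {x, z}}"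
    then have "\<exists>c\<in>{{x, y}, {y, z}, {x, z}}. \<sigma> = convex hull c"
      by simp
    then obtain c where c: "c \<in> {{x, y}, {y, z}, {x, z}}" "\<sigma> = convex hull c" ..
    then have "c \<subseteq> C"
      using xyz(1) by auto
    then have "\<sigma> face_of f" "1 simplex \<sigma>"
      using face[of \<sigma>] two[of c] c by auto
    then show "\<sigma> \<in> {\<sigma>\<in>edges \<T>. \<sigma> face_of f}"
      using in_\<T> by (auto simp: edges_def)
  qed
  moreover from this have "{convex hull {x, y}, convex hull {y, z}, convex hull {x, z}} \<subseteq> range e"
    using e unfolding bij_betw_def by blast
  then obtain i j k where "convex hull {x, y} = e i" "convex hull {y, z} = e j"
      "convex hull {x, z} = e k"
    by (simp add: image_iff) blast
  ultimately show ?thesis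
    by (intro that[of i j k]) (simp add: face_triple_def)
qed

section \<open>Permutations of triples\<close>

lemma face_triple_perm:
  assumes "face_triple \<T> e f (i, j, k)"
  shows "face_triple \<T> e f (j, k, i)" "face_triple \<T> e f (j, i, k)"
  using assms unfolding face_triple_def by auto

lemma admissible_cyclic:
  assumes "admissible_triples \<T> e J" "(i, j, k) \<in> J"
  shows "(j, k, i) \<in> J" "(k, i, j) \<in> J"
  using assms unfolding admissible_triples_def by blast+

lemma admissible_odd:
  assumes "admissible_triples \<T> e J" "(i, j, k) \<in> J"
  shows "(j, i, k) \<notin> J" "(i, k, j) \<notin> J" "(k, j, i) \<notin> J"
  using assms unfolding admissible_triples_def by blast+

text \<open>The six permutations form two cyclic classes, and \<open>J\<close> is closed under
  cyclic permutation, so one representative of each class suffices.\<close>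

lemma admissible_face:
  assumes J: "admissible_triples \<T> e J" and "f \<in> faces \<T>" "face_triple \<T> e f (i, j, k)"
  shows "(i, j, k) \<in> J \<or> (i, k, j) \<in> J"
proof -
  have "(i, j, k) \<in> J \<or> (j, k, i) \<in> J \<or> (k, i, j) \<in> J \<or>
      (j, i, k) \<in> J \<or> (i, k, j) \<in> J \<or> (k, j, i) \<in> J"
    using assms unfolding admissible_triples_def by blast
  then show ?thesis
    using admissible_cyclic[OF J] by blast
qed

lemma admissible_ex_face:
  assumes "admissible_triples \<T> e J" "t \<in> J"
  obtains f where "f \<in> faces \<T>" "face_triple \<T> e f t"
  using assms unfolding admissible_triples_def by blast

lemma subspace_range_metric_coords: "subspace (range (metric_coords J))"
proof -
  have "metric_coords J (\<lambda>_. 0) = 0"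
    by (auto simp: metric_coords_def vec_eq_iff)
  moreover have "metric_coords J l + metric_coords J m = metric_coords J (\<lambda>i. l i + m i)" for l m
    by (auto simp: metric_coords_def vec_eq_iff field_simps)
  moreover have "s *\<^sub>R metric_coords J l = metric_coords J (\<lambda>i. s * l i)" for s l
    by (auto simp: metric_coords_def vec_eq_iff field_simps)
  ultimately show ?thesis
    unfolding subspace_def by (auto simp: image_iff)
qed

lemma metric_coords_nth:
  "(i, j, k) \<in> J \<Longrightarrow> metric_coords J l $ (i, j, k) = (l j + l k - l i) / 2"
  by (simp add: metric_coords_def)

lemma metric_coords_nth_outside: "t \<notin> J \<Longrightarrow> metric_coords J l $ t = 0"
  by (simp add: metric_coords_def)

text \<open>An edge that belongs to no face does not affect the coordinates, so its length may be
  changed to 1.\<close>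

lemma sing_metrics_eq:
  assumes J: "admissible_triples \<T> e J"
  shows "sing_metrics \<T> e J = range (metric_coords J) \<inter> orthant J"
proof (intro equalityI subsetI)
  fix A assume "A \<in> sing_metrics \<T> e J"
  then obtain l where l: "l \<in> edge_lengths \<T> e" "A = metric_coords J l"
    by (auto simp: sing_metrics_def)
  have "0 < A $ t" if t: "t \<in> J" for t
  proof -
    obtain i j k where ijk: "t = (i, j, k)" by (cases t)
    obtain f where "f \<in> faces \<T>" "face_triple \<T> e f t"
      using admissible_ex_face[OF J t] .
    then have "l i < l j + l k"
      using l(1) by (auto simp: edge_lengths_def ijk)
    then show ?thesis
      using t by (simp add: l(2) ijk metric_coords_nth)
  qed
  then show "A \<in> range (metric_coords J) \<inter> orthant J"
    using l(2) by (auto simp: orthant_def)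
next
  fix A assume "A \<in> range (metric_coords J) \<inter> orthant J"
  then obtain l where l: "A = metric_coords J l" and A: "\<And>t. t \<in> J \<Longrightarrow> 0 < A $ t"
    by (auto simp: orthant_def)
  define l' where "l' i = (if 0 < l i then l i else 1)" for i
  \<comment> \<open>Each length in a triple is the sum of two positive coordinates, and positivity
    of the coordinate at \<open>(i, j, k)\<close> is the triangle inequality.\<close>
  have l_pos: "0 < l i" "0 < l j" "0 < l k" and tri: "l i < l j + l k" if "(i, j, k) \<in> J" for i j k
    using A[OF that] A[OF admissible_cyclic(1)[OF J that]] A[OF admissible_cyclic(2)[OF J that]]
      that admissible_cyclic[OF J that] by (simp_all add: l metric_coords_nth)
  have "metric_coords J l' $ t = A $ t" for t
  proof (cases "t \<in> J")
    case True
    then show ?thesis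
      using l_pos by (cases t) (simp add: l metric_coords_nth l'_def)
  qed (simp add: l metric_coords_nth_outside)
  then have "A = metric_coords J l'"
    by (simp add: vec_eq_iff)
  moreover have "l' \<in> edge_lengths \<T> e"
    unfolding edge_lengths_def
  proof (intro CollectI conjI allI ballI impI)
    fix f i j k assume "f \<in> faces \<T>" "face_triple \<T> e f (i, j, k)"
    then have "(i, j, k) \<in> J \<or> (i, k, j) \<in> J"
      by (rule admissible_face[OF J])
    then show "l' i < l' j + l' k"
    proof
      assume "(i, j, k) \<in> J"
      from l_pos[OF this] tri[OF this] show ?thesis by (simp add: l'_def)
    next
      assume "(i, k, j) \<in> J"
      from l_pos[OF this] tri[OF this] show ?thesis by (simp add: l'_def)
    qed
  qed (simp add: l'_def)
  ultimately show "A \<in> sing_metrics \<T> e J"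
    by (auto simp: sing_metrics_def)
qed

section \<open>The area of one triangle and its derivative\<close>

lemma triple_area_pos:
  assumes "{(i, j, k), (j, k, i), (k, i, j)} \<subseteq> J" "x \<in> orthant J"
  shows "0 < triple_area x (i, j, k)"
  using assms by (auto simp: triple_area_def orthant_def intro!: mult_pos_pos add_pos_pos)

lemma triple_area_scaleR: "triple_area (s *\<^sub>R x) t = s\<^sup>2 * triple_area x t"
proof -
  obtain i j k where t: "t = (i, j, k)" by (cases t)
  let ?a = "x $ (i, j, k)" and ?b = "x $ (j, k, i)" and ?c = "x $ (k, i, j)"
  have "(s * ?a + s * ?b + s * ?c) * (s * ?a) * (s * ?b) * (s * ?c) =
      (s\<^sup>2)\<^sup>2 * ((?a + ?b + ?c) * ?a * ?b * ?c)"
    by (simp add: power2_eq_square algebra_simps)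
  moreover have "sqrt ((s\<^sup>2)\<^sup>2 * y) = s\<^sup>2 * sqrt y" for y
    by (simp only: real_sqrt_mult real_sqrt_abs abs_power2)
  ultimately show ?thesis
    unfolding triple_area_def t
    by (simp only: prod.case vector_scaleR_component real_scaleR_def)
qed

lemma C1_map_on_triple_area:
  assumes "{(i, j, k), (j, k, i), (k, i, j)} \<subseteq> J"
  shows "C1_map_on (orthant J) (\<lambda>x. triple_area x (i, j, k))"
  unfolding triple_area_def prod.case
  by (intro C1_map_on_sqrt C1_map_on_mult C1_map_on_add C1_map_on_bounded_linear
      bounded_linear_vec_nth mult_pos_pos add_pos_pos)
    (use assms in \<open>auto simp: orthant_def\<close>)

text \<open>The three partial derivatives are positive. Hence \<open>D v\<close> is a sum of
  nonpositive terms when \<open>v\<close> has no positive coordinate in \<open>J\<close>, and it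
  vanishes only if the three coordinates of the triangle do.\<close>

lemma triple_area_deriv:
  assumes J: "{(i, j, k), (j, k, i), (k, i, j)} \<subseteq> J" and x: "x \<in> orthant J"
  obtains D where "((\<lambda>x. triple_area x (i, j, k)) has_derivative D) (at x)"
    "\<And>v. \<forall>t\<in>J. v $ t \<le> 0 \<Longrightarrow> D v \<le> 0"
    "\<And>v t. \<forall>t\<in>J. v $ t \<le> 0 \<Longrightarrow> D v = 0 \<Longrightarrow>
      t \<in> {(i, j, k), (j, k, i), (k, i, j)} \<Longrightarrow> v $ t = 0"
proof -
  define a b c where "a = x $ (i, j, k)" and "b = x $ (j, k, i)" and "c = x $ (k, i, j)"
  have pos: "0 < a" "0 < b" "0 < c"
    using J x by (auto simp: a_def b_def c_def orthant_def)
  define P where "P = (a + b + c) * a * b * c"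
  have "0 < P"
    using pos by (simp add: P_def)
  \<comment> \<open>The partial derivatives of \<open>P\<close> in \<open>a\<close>,
    \<open>b\<close> and \<open>c\<close>.\<close>
  define \<alpha> \<beta> \<gamma> where "\<alpha> = a * b * c + (a + b + c) * (b * c)"
    and "\<beta> = a * b * c + (a + b + c) * (a * c)" and "\<gamma> = a * b * c + (a + b + c) * (a * b)"
  have coeff: "0 < \<alpha>" "0 < \<beta>" "0 < \<gamma>"
    using pos by (auto simp: \<alpha>_def \<beta>_def \<gamma>_def intro!: add_pos_pos mult_pos_pos)
  define D where "D v = (\<alpha> * v $ (i, j, k) + \<beta> * v $ (j, k, i) + \<gamma> * v $ (k, i, j)) / (2 * sqrt P)"
    for v :: "real^('a \<times> 'a \<times> 'a)"
  have nth: "((\<lambda>x. x $ t) has_derivative (\<lambda>v. v $ t)) (at x)" for t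
    by (rule bounded_linear_imp_has_derivative[OF bounded_linear_vec_nth])
  have "((\<lambda>x. (x $ (i, j, k) + x $ (j, k, i) + x $ (k, i, j)) *
           x $ (i, j, k) * x $ (j, k, i) * x $ (k, i, j)) has_derivative
      (\<lambda>v. \<alpha> * v $ (i, j, k) + \<beta> * v $ (j, k, i) + \<gamma> * v $ (k, i, j))) (at x)"
    by (rule derivative_eq_intros nth refl)+
      (auto simp: \<alpha>_def \<beta>_def \<gamma>_def a_def b_def c_def algebra_simps)
  from has_derivative_real_sqrt[OF _ this]
  have "((\<lambda>x. triple_area x (i, j, k)) has_derivative D) (at x)"
    using \<open>0 < P\<close> unfolding triple_area_def prod.case D_def P_def a_def b_def c_def
    by (simp add: field_simps)
  moreover have terms: "\<alpha> * v $ (i, j, k) \<le> 0" "\<beta> * v $ (j, k, i) \<le> 0" "\<gamma> * v $ (k, i, j) \<le> 0"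
    if "\<forall>t\<in>J. v $ t \<le> 0" for v :: "real^('a \<times> 'a \<times> 'a)"
    using that J coeff by (auto intro!: mult_nonneg_nonpos)
  then have "D v \<le> 0" if "\<forall>t\<in>J. v $ t \<le> 0" for v
    using terms[OF that] \<open>0 < P\<close> unfolding D_def by (intro divide_nonpos_pos) auto
  moreover have "v $ t = 0" if "\<forall>t\<in>J. v $ t \<le> 0" "D v = 0"
    "t \<in> {(i, j, k), (j, k, i), (k, i, j)}" for v t
  proof -
    have "\<alpha> * v $ (i, j, k) + \<beta> * v $ (j, k, i) + \<gamma> * v $ (k, i, j) = 0"
      using that(2) \<open>0 < P\<close> by (simp add: D_def)
    then have "\<alpha> * v $ (i, j, k) = 0" "\<beta> * v $ (j, k, i) = 0" "\<gamma> * v $ (k, i, j) = 0"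
      using terms[OF that(1)] by linarith+
    then show ?thesis
      using coeff that(3) by auto
  qed
  ultimately show ?thesis
    by (rule that)
qed

text \<open>A name for the choice made inside \<open>area\<close>.\<close>

definition area_triple ::
    "'a::euclidean_space set set \<Rightarrow> ('i \<Rightarrow> 'a set) \<Rightarrow> ('i \<times> 'i \<times> 'i) set \<Rightarrow> 'a set \<Rightarrow> 'i \<times> 'i \<times> 'i" where
  "area_triple \<T> e J f = (SOME t. t \<in> J \<and> face_triple \<T> e f t)"

definition cyclic :: "'i \<times> 'i \<times> 'i \<Rightarrow> ('i \<times> 'i \<times> 'i) set" where
  "cyclic = (\<lambda>(i, j, k). {(i, j, k), (j, k, i), (k, i, j)})"

lemma area_eq: "area \<T> e J x = (\<Sum>f\<in>faces \<T>. triple_area x (area_triple \<T> e J f))"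
  by (simp add: area_def area_triple_def)

section \<open>The total area and its derivative\<close>

locale triangulated =
  fixes \<T> :: "'a::euclidean_space set set" and e :: "'i::finite \<Rightarrow> 'a set"
    and J :: "('i \<times> 'i \<times> 'i) set"
  assumes complex: "simplicial_complex \<T>" and e: "bij_betw e UNIV (edges \<T>)"
    and J: "admissible_triples \<T> e J"
begin

lemma finite_faces: "finite (faces \<T>)"
  using complex by (simp add: faces_def simplicial_complex_def)

lemma area_triple:
  assumes "f \<in> faces \<T>"
  shows "area_triple \<T> e J f \<in> J" "face_triple \<T> e f (area_triple \<T> e J f)"
proof -
  obtain i j k where ijk: "face_triple \<T> e f (i, j, k)"
    using ex_face_triple[OF complex e assms] .
  have "\<exists>t. t \<in> J \<and> face_triple \<T> e f t"
    using admissible_face[OF J assms ijk] ijk face_triple_perm by metis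
  from someI_ex[OF this] show "area_triple \<T> e J f \<in> J" "face_triple \<T> e f (area_triple \<T> e J f)"
    by (auto simp: area_triple_def)
qed

lemma area_triple_cases:
  assumes "f \<in> faces \<T>"
  obtains i j k where "area_triple \<T> e J f = (i, j, k)"
    "{(i, j, k), (j, k, i), (k, i, j)} \<subseteq> J"
proof -
  obtain i j k where ijk: "area_triple \<T> e J f = (i, j, k)"
    by (metis prod_cases3)
  then have "(i, j, k) \<in> J"
    using area_triple(1)[OF assms] by simp
  then show ?thesis
    using that ijk admissible_cyclic[OF J] by blast
qed

text \<open>Ensures that every coordinate in \<open>J\<close> enters the area. By injectivity of
  \<open>e\<close>, \<open>t\<close> and the chosen triple of its face are arrangements of the same
  three indices, and admissibility excludes the odd ones.\<close>

lemma cyclic_area_triple: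
  assumes "t \<in> J"
  obtains f where "f \<in> faces \<T>" "t \<in> cyclic (area_triple \<T> e J f)"
proof -
  obtain i j k where ijk: "t = (i, j, k)" by (cases t)
  obtain f where f: "f \<in> faces \<T>" "face_triple \<T> e f t"
    using admissible_ex_face[OF J assms] .
  obtain a b c where abc: "area_triple \<T> e J f = (a, b, c)"
    by (metis prod_cases3)
  have in_J: "(a, b, c) \<in> J" "(i, j, k) \<in> J"
    using area_triple(1)[OF f(1)] assms by (auto simp: abc ijk)
  have "e ` {i, j, k} = e ` {a, b, c}"
    using trans[OF sym[OF f(2)[unfolded face_triple_def ijk prod.case]]
        area_triple(2)[OF f(1), unfolded face_triple_def abc prod.case]]
    by (simp only: image_insert image_empty)
  then have "{i, j, k} = {a, b, c}"
    using e by (simp only: inj_image_eq_iff bij_betw_def)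
  then have "i \<in> {a, b, c}" "j \<in> {a, b, c}" "k \<in> {a, b, c}"
    by blast+
  \<comment> \<open>If two indices agreed, swapping them would be an odd permutation that fixes the
    triple.\<close>
  moreover have "i \<noteq> j" "i \<noteq> k" "j \<noteq> k"
    using admissible_odd[OF J in_J(2)] in_J(2) by auto
  ultimately have "i = a \<and> j = b \<and> k = c \<or> i = b \<and> j = c \<and> k = a \<or> i = c \<and> j = a \<and> k = b \<or>
      i = b \<and> j = a \<and> k = c \<or> i = a \<and> j = c \<and> k = b \<or> i = c \<and> j = b \<and> k = a"
    by auto
  then have "t \<in> cyclic (a, b, c)"
    using admissible_odd[OF J in_J(1)] in_J(2) by (auto simp: ijk cyclic_def)
  then show ?thesis
    using that[OF f(1)] by (simp add: abc)
qed

lemma area_pos: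
  assumes "J \<noteq> {}" "x \<in> orthant J"
  shows "0 < area \<T> e J x"
  unfolding area_eq
proof (rule sum_pos[OF finite_faces])
  show "faces \<T> \<noteq> {}"
    using assms(1) admissible_ex_face[OF J] by blast
  show "0 < triple_area x (area_triple \<T> e J f)" if "f \<in> faces \<T>" for f
    using area_triple_cases[OF that] triple_area_pos[OF _ assms(2)] by metis
qed

lemma area_scaleR: "area \<T> e J (s *\<^sub>R x) = s\<^sup>2 * area \<T> e J x"
  by (simp add: area_eq triple_area_scaleR sum_distrib_left)

lemma C1_map_on_area: "C1_map_on (orthant J) (area \<T> e J)"
proof -
  have "C1_map_on (orthant J) (\<lambda>x. \<Sum>f\<in>faces \<T>. triple_area x (area_triple \<T> e J f))"
  proof (rule C1_map_on_sum[OF finite_faces])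
    fix f assume "f \<in> faces \<T>"
    then show "C1_map_on (orthant J) (\<lambda>x. triple_area x (area_triple \<T> e J f))"
      using area_triple_cases C1_map_on_triple_area by metis
  qed
  then show ?thesis
    by (simp add: area_eq[abs_def])
qed

text \<open>On a vector without positive coordinate in \<open>J\<close> each face contributes at
  most 0. If the sum is 0, every contribution vanishes, and each coordinate in \<open>J\<close>
  belongs to some face.\<close>

lemma area_deriv:
  assumes x: "x \<in> orthant J"
  obtains D where "(area \<T> e J has_derivative D) (at x)"
    "\<forall>v. (\<forall>t\<in>J. v $ t \<le> 0) \<longrightarrow> D v = 0 \<longrightarrow> (\<forall>t\<in>J. v $ t = 0)"
proof -
  let ?P = "\<lambda>f D. ((\<lambda>x. triple_area x (area_triple \<T> e J f)) has_derivative D) (at x) \<and>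
      (\<forall>v. (\<forall>t\<in>J. v $ t \<le> 0) \<longrightarrow> D v \<le> 0) \<and>
      (\<forall>v. (\<forall>t\<in>J. v $ t \<le> 0) \<longrightarrow> D v = 0 \<longrightarrow> (\<forall>t\<in>cyclic (area_triple \<T> e J f). v $ t = 0))"
  have "\<forall>f\<in>faces \<T>. \<exists>D. ?P f D"
  proof
    fix f assume f: "f \<in> faces \<T>"
    obtain i j k where ijk: "area_triple \<T> e J f = (i, j, k)"
      "{(i, j, k), (j, k, i), (k, i, j)} \<subseteq> J"
      using area_triple_cases[OF f] .
    obtain D where D: "((\<lambda>x. triple_area x (i, j, k)) has_derivative D) (at x)"
      "\<And>v. \<forall>t\<in>J. v $ t \<le> 0 \<Longrightarrow> D v \<le> 0"
      "\<And>v t. \<forall>t\<in>J. v $ t \<le> 0 \<Longrightarrow> D v = 0 \<Longrightarrow>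
        t \<in> {(i, j, k), (j, k, i), (k, i, j)} \<Longrightarrow> v $ t = 0"
      by (rule triple_area_deriv[OF ijk(2) x]) blast
    have "?P f D"
      unfolding ijk(1) cyclic_def prod.case
      by (intro conjI allI impI ballI) (fact D(1), erule D(2), erule (2) D(3))
    then show "\<exists>D. ?P f D"
      by (rule exI[of "?P f" D])
  qed
  from bchoice[OF this] obtain D where "\<forall>f\<in>faces \<T>. ?P f (D f)" ..
  then have D:
    "\<And>f. f \<in> faces \<T> \<Longrightarrow> ((\<lambda>x. triple_area x (area_triple \<T> e J f)) has_derivative D f) (at x)"
    "\<And>f v. f \<in> faces \<T> \<Longrightarrow> \<forall>t\<in>J. v $ t \<le> 0 \<Longrightarrow> D f v \<le> 0"
    "\<And>f v t. f \<in> faces \<T> \<Longrightarrow> \<forall>t\<in>J. v $ t \<le> 0 \<Longrightarrow> D f v = 0 \<Longrightarrow>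
      t \<in> cyclic (area_triple \<T> e J f) \<Longrightarrow> v $ t = 0"
    by (simp, simp, blast)
  show ?thesis
  proof
    show "(area \<T> e J has_derivative (\<lambda>v. \<Sum>f\<in>faces \<T>. D f v)) (at x)"
      unfolding area_eq[abs_def] by (rule has_derivative_sum) (rule D(1))
    show "\<forall>v. (\<forall>t\<in>J. v $ t \<le> 0) \<longrightarrow> (\<Sum>f\<in>faces \<T>. D f v) = 0 \<longrightarrow> (\<forall>t\<in>J. v $ t = 0)"
    proof (intro allI impI ballI)
      fix v t assume v: "\<forall>t\<in>J. v $ t \<le> 0" "(\<Sum>f\<in>faces \<T>. D f v) = 0" "t \<in> J"
      obtain f where f: "f \<in> faces \<T>" "t \<in> cyclic (area_triple \<T> e J f)"
        using cyclic_area_triple[OF v(3)] .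
      \<comment> \<open>Signs are reversed to apply the fact that a zero sum of nonnegative terms
        has zero terms.\<close>
      have "(\<Sum>f\<in>faces \<T>. - D f v) = 0"
        unfolding sum_negf v(2) by simp
      then have "- D f v = 0"
        by (rule sum_nonneg_0[OF finite_faces _ _ f(1), rotated]) (use D(2) v(1) in simp)
      then have "D f v = 0"
        by simp
      then show "v $ t = 0"
        by (rule D(3)[OF f(1) v(1) _ f(2)])
    qed
  qed
qed

lemma unit_metrics_finsler:
  assumes "J \<noteq> {}"
  shows "finsler_structure_on (unit_metrics \<T> e J) (F_norm J) \<and>
    (\<forall>A\<in>unit_metrics \<T> e J. \<forall>B\<in>unit_metrics \<T> e J.
       ereal (eta J A B) =
         (INF c\<in>curves_from_to (unit_metrics \<T> e J) A B. ereal (finsler_length (F_norm J) c)))"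
proof -
  let ?r = "\<lambda>x. sqrt (area \<T> e J x)"
  have "C1_map_on (orthant J) ?r"
    by (intro C1_map_on_sqrt C1_map_on_area area_pos assms)
  then obtain r' where r': "\<forall>x\<in>orthant J. (?r has_derivative blinfun_apply (r' x)) (at x)"
      "continuous_on (orthant J) r'"
    unfolding C1_map_on_def by (elim exE conjE) (rule that)
  have mono: "\<forall>t\<in>J. v $ t = 0"
    if x: "x \<in> orthant J" and v: "\<And>t. t \<in> J \<Longrightarrow> v $ t \<le> 0" "r' x v = 0" for x v
  proof -
    obtain D where D: "(area \<T> e J has_derivative D) (at x)"
      "\<forall>v. (\<forall>t\<in>J. v $ t \<le> 0) \<longrightarrow> D v = 0 \<longrightarrow> (\<forall>t\<in>J. v $ t = 0)"
      by (rule area_deriv[OF x]) (rule that)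
    have pos: "0 < area \<T> e J x"
      using assms x by (rule area_pos)
    have "(?r has_derivative (\<lambda>v. D v * (inverse (?r x) / 2))) (at x)"
      by (rule has_derivative_real_sqrt[OF _ D(1)]) (rule pos)
    \<comment> \<open>\<open>r'\<close> is known only through the existence statement in
      \<open>C1_map_on\<close>; uniqueness of derivatives makes it a positive multiple of
      \<open>D\<close>.\<close>
    then have "blinfun_apply (r' x) = (\<lambda>v. D v * (inverse (?r x) / 2))"
      by (rule has_derivative_unique[OF bspec[OF r'(1) x]])
    then have "D v = 0"
      using v(2) pos by simp
    then show ?thesis
      using D(2) v(1) by simp
  qed
  interpret cone_section J "range (metric_coords J)" ?r r'
  proof
    show "0 < ?r x" if "x \<in> orthant J" for x
      using area_pos[OF assms that] by simp
    show "?r (s *\<^sub>R x) = s * ?r x" if "0 < s" "x \<in> orthant J" for s x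
      unfolding area_scaleR using that by (simp only: real_sqrt_mult real_sqrt_abs abs_of_pos)
    show "w $ t = 0" if "w \<in> range (metric_coords J)" "t \<notin> J" for w t
      using that by (auto simp: metric_coords_nth_outside)
    show "(?r has_derivative r' x) (at x)" if "x \<in> orthant J" for x
      using r'(1) that by (rule bspec)
    show "\<forall>t\<in>J. v $ t = 0"
      if "x \<in> orthant J" "\<And>t. t \<in> J \<Longrightarrow> v $ t \<le> 0" "r' x v = 0" for x v
      using that by (rule mono)
  qed (rule assms subspace_range_metric_coords r'(2))+
  have M: "unit_metrics \<T> e J = M"
    unfolding unit_metrics_def M_def sing_metrics_eq[OF J] real_sqrt_eq_1_iff ..
  show ?thesis
    unfolding M by (intro conjI ballI finsler_structure_on_M eta_eq_INF_length)
qed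

end

theorem theorem4p9:
  fixes S :: "'s topology"
    and \<T> :: "'a::euclidean_space set set"
    and e :: "'i::finite \<Rightarrow> 'a set"
    and J :: "('i \<times> 'i \<times> 'i) set"
  assumes "compact_surface S"
    and "triangulation_of S \<T>"
    and "bij_betw e UNIV (edges \<T>)"
    and "admissible_triples \<T> e J"
  shows "finsler_structure_on (unit_metrics \<T> e J) (F_norm J) \<and>
    (\<forall>A\<in>unit_metrics \<T> e J. \<forall>B\<in>unit_metrics \<T> e J.
       ereal (eta J A B) =
         (INF c\<in>curves_from_to (unit_metrics \<T> e J) A B. ereal (finsler_length (F_norm J) c)))"
proof -
  interpret triangulated \<T> e J
    by unfold_locales (use assms in \<open>auto simp: triangulation_of_def\<close>)
  show ?thesis
  proof (cases "J = {}")
    case True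
    \<comment> \<open>Without faces the area is the empty sum 0, so no metric has area 1 and the
      claim is vacuous.\<close>
    then have "faces \<T> = {}"
      using area_triple(1) by blast
    then have "unit_metrics \<T> e J = {}"
      by (simp add: unit_metrics_def area_eq)
    then show ?thesis
      by (simp add: finsler_structure_on_def embedded_submanifold_def tangent_bundle_def)
  next
    case False
    then show ?thesis
      by (rule unit_metrics_finsler)
  qed
qed

end
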